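(* Let $G=(V,E)$ be a finite connected graph whose resistance curvature is bounded from below by $K>0$, i.e. $\kappa_v\ge K$ for all $v\in V$. Then the smallest positive eigenvalue $\lambda_2$ of the Laplacian $L=D-A$ satisfies $\lambda_2\geq 2K$.
   Context: Throughout, $G=(V,E)$ is a finite, simple, connected graph with vertices $v_1,\dots,v_n$, $n\ge 2$. Let $D$ be the diagonal degree matrix, $A$ the adjacency matrix, and $\Gamma = D-A+\frac1n J$, where $J$ is the $n\times n$ all-ones matrix. The resistance matrix $\Omega$ is defined by $\Omega_{ij}=(\Gamma^{-1})_{ii}+(\Gamma^{-1})_{jj}-2(\Gamma^{-1})_{ij}$; it is invertible. The resistance curvature is the unique vector $\kappa\in\mathbb{R}^n$ with $\Omega\kappa=\mathbf{1}$, $\mathbf 1=(1,\dots,1)$; $\kappa_i$ is the curvature at $v_i$. *)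

theory Defs
  imports "HOL-Analysis.Analysis" "Graph_Theory.Graph_Theory"
begin

text \<open>
  An undirected simple graph is a \<open>pair_graph\<close>: a finite symmetric loop-free set of ordered pairs,
  each edge being represented by its two orientations.  The vertices are the elements of the finite
  index type \<open>'n\<close>, so that matrices indexed by the vertices have type \<open>real^'n^'n\<close>.
  The qualified name in \<open>connected\<close> is needed because topological connectedness has the same base
  name.
\<close>

locale connected_graph = pair_graph G for G :: "'n::finite pair_pre_digraph" +
  assumes verts_UNIV: "pverts G = UNIV"
    and connected: "Digraph_Component.connected (with_proj G)"
    and card_ge_2: "CARD('n) \<ge> 2"

definition degree_matrix :: "'n::finite pair_pre_digraph \<Rightarrow> real^'n^'n" where
  "degree_matrix G = (\<chi> i j. if i = j then real (out_degree (with_proj G) i) else 0)"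

definition adjacency_matrix :: "'n::finite pair_pre_digraph \<Rightarrow> real^'n^'n" where
  "adjacency_matrix G = (\<chi> i j. if (i, j) \<in> parcs G then 1 else 0)"

definition laplacian :: "'n::finite pair_pre_digraph \<Rightarrow> real^'n^'n" where
  "laplacian G = degree_matrix G - adjacency_matrix G"

definition all_ones :: "real^'n^'n::finite" where
  "all_ones = (\<chi> i j. 1)"

definition Gamma_matrix :: "'n::finite pair_pre_digraph \<Rightarrow> real^'n^'n" where
  "Gamma_matrix G =
     degree_matrix G - adjacency_matrix G + (1 / real CARD('n)) *\<^sub>R (all_ones :: real^'n^'n)"

definition resistance_matrix :: "'n::finite pair_pre_digraph \<Rightarrow> real^'n^'n" where
  "resistance_matrix G =
     (let H = matrix_inv (Gamma_matrix G) in (\<chi> i j. H $ i $ i + H $ j $ j - 2 * H $ i $ j))"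

text \<open>On vectors, \<open>1\<close> is the all-ones vector.\<close>

definition resistance_curvature :: "'n::finite pair_pre_digraph \<Rightarrow> real^'n" where
  "resistance_curvature G = (THE \<kappa>. resistance_matrix G *v \<kappa> = 1)"

definition eigenvalue :: "real^'n^'n::finite \<Rightarrow> real \<Rightarrow> bool" where
  "eigenvalue M c \<longleftrightarrow> (\<exists>x. x \<noteq> 0 \<and> M *v x = c *\<^sub>R x)"

definition lambda2 :: "'n::finite pair_pre_digraph \<Rightarrow> real" where
  "lambda2 G = Min {c. eigenvalue (laplacian G) c \<and> c > 0}"

end

theory Submission
  imports Defs
begin

text \<open>
  Put \<open>H = \<Gamma>\<inverse>\<close>.  If \<open>L f = c f\<close> with \<open>c > 0\<close>, then \<open>f\<close> sums to zero and
  \<open>H f = f / c\<close>, so \<open>- f \<bullet> \<Omega> f = 2 (f \<bullet> H f) = (2 / c) (f \<bullet> f)\<close>.  On the other hand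
  \<open>\<Omega>\<close> is symmetric with nonnegative entries and \<open>\<Omega> \<kappa> = 1\<close> with \<open>\<kappa> \<ge> K\<close>, so AM-GM gives
  \<open>- f \<bullet> \<Omega> f \<le> (f \<bullet> f) / K\<close>, whence \<open>c \<ge> 2 K\<close>.
\<close>

section \<open>Symmetric matrices\<close>

lemma symmetric_matrix_inner:
  fixes M :: "real^'n^'n::finite"
  assumes "transpose M = M"
  shows "(M *v x) \<bullet> y = x \<bullet> (M *v y)"
  by (metis assms dot_lmul_matrix vector_transpose_matrix)

text \<open>Eigenvectors picked for distinct eigenvalues are orthogonal, hence independent, so only
  finitely many fit. This is what gives the \<open>Min\<close> in \<open>lambda2\<close> a
  meaning.\<close>

lemma finite_eigenvalues_symmetric:
  fixes M :: "real^'n^'n::finite"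
  assumes sym: "transpose M = M"
  shows "finite {c. eigenvalue M c}"
proof -
  define v where "v c = (SOME x. x \<noteq> 0 \<and> M *v x = c *\<^sub>R x)" for c
  have v: "v c \<noteq> 0 \<and> M *v v c = c *\<^sub>R v c" if "eigenvalue M c" for c
    unfolding v_def by (rule someI_ex) (use that in \<open>simp add: eigenvalue_def\<close>)
  let ?E = "{c. eigenvalue M c}"
  have orth: "v c \<bullet> v d = 0" if "c \<in> ?E" "d \<in> ?E" "c \<noteq> d" for c d
  proof -
    have "c * (v c \<bullet> v d) = d * (v c \<bullet> v d)"
      using symmetric_matrix_inner[OF sym, of "v c" "v d"] v[of c] v[of d] that by simp
    then show ?thesis using that by simp
  qed
  have inj: "inj_on v ?E"
    by (rule inj_onI) (metis inner_eq_zero_iff mem_Collect_eq orth v)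
  have "pairwise orthogonal (v ` ?E)"
    unfolding pairwise_def orthogonal_def using orth by blast
  moreover have "0 \<notin> v ` ?E" using v by force
  ultimately have "independent (v ` ?E)" by (rule pairwise_orthogonal_independent)
  then have "finite (v ` ?E)" by (rule independent_imp_finite)
  then show ?thesis using inj by (rule finite_imageD)
qed

text \<open>At a zero \<open>x\<close> of the form, a small step along \<open>-(M *v x)\<close>
  would make the form negative, since its linear term dominates.\<close>

lemma psd_kernel:
  fixes M :: "real^'n^'n::finite"
  assumes sym: "transpose M = M" and psd: "\<And>y. y \<bullet> (M *v y) \<ge> 0" and zero: "x \<bullet> (M *v x) = 0"
  shows "M *v x = 0"
proof (rule ccontr)
  define z where "z = M *v x"
  assume "M *v x \<noteq> 0"
  then have zz: "z \<bullet> z > 0" by (simp add: z_def)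
  define q where "q = z \<bullet> (M *v z)"
  have q: "q \<ge> 0" unfolding q_def by (rule psd)
  \<comment> \<open>The exact minimizer would divide by \<open>q\<close>, which may be zero; with
    \<open>q + 1\<close> the quadratic term still cannot outweigh the linear one.\<close>
  define t where "t = - (z \<bullet> z) / (q + 1)"
  have "(x + t *\<^sub>R z) \<bullet> (M *v (x + t *\<^sub>R z)) = 2 * t * (z \<bullet> z) + t\<^sup>2 * q"
    using zero symmetric_matrix_inner[OF sym, of x z]
    by (simp add: matrix_vector_right_distrib matrix_vector_mult_scaleR inner_simps z_def[symmetric]
        q_def[symmetric] power2_eq_square algebra_simps)
  also have "\<dots> = t * (2 * (z \<bullet> z) + t * q)"
    by (simp add: power2_eq_square algebra_simps)
  also have "t * q = - (q / (q + 1)) * (z \<bullet> z)"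
    by (simp add: t_def)
  also have "2 * (z \<bullet> z) + \<dots> = (2 - q / (q + 1)) * (z \<bullet> z)"
    by (simp add: algebra_simps)
  also have "t * \<dots> < 0"
  proof (intro mult_neg_pos mult_pos_pos zz)
    show "t < 0" using q zz by (simp add: t_def divide_neg_pos)
    show "2 - q / (q + 1) > 0" using q by (simp add: field_simps)
  qed
  finally show False using psd[of "x + t *\<^sub>R z"] by simp
qed

text \<open>A maximizer of the quadratic form on the unit sphere is an eigenvector.\<close>

lemma symmetric_positive_eigenvalue:
  fixes M :: "real^'n^'n::finite"
  assumes sym: "transpose M = M" and pos: "y \<bullet> (M *v y) > 0"
  obtains c where "eigenvalue M c" "c > 0"
proof -
  let ?S = "sphere 0 1 :: (real^'n) set"
  have y0: "y \<noteq> 0" using pos by auto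
  have "continuous_on ?S (\<lambda>x. x \<bullet> (M *v x))"
    by (intro continuous_on_inner continuous_on_id linear_continuous_on
        linear_linear[THEN iffD2] matrix_vector_mul_linear)
  moreover have "sgn y \<in> ?S" using y0 by (simp add: norm_sgn)
  ultimately obtain x where x: "x \<in> ?S" and max: "\<And>z. z \<in> ?S \<Longrightarrow> z \<bullet> (M *v z) \<le> x \<bullet> (M *v x)"
    using continuous_attains_sup[OF compact_sphere, of 0 1 "\<lambda>x. x \<bullet> (M *v x)"] by blast
  define c where "c = x \<bullet> (M *v x)"
  have bound: "z \<bullet> (M *v z) \<le> c * (z \<bullet> z)" for z
  proof (cases "z = 0")
    case False
    have "sgn z \<bullet> (M *v sgn z) \<le> c"
      unfolding c_def by (rule max) (use False in \<open>simp add: norm_sgn\<close>)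
    then have "(z \<bullet> (M *v z)) / (norm z)\<^sup>2 \<le> c"
      by (simp add: sgn_div_norm matrix_vector_mult_scaleR power2_eq_square divide_inverse mult_ac)
    then show ?thesis using False by (simp add: divide_le_eq power2_norm_eq_inner)
  qed simp
  have "c > 0"
  proof -
    have "0 < c * (y \<bullet> y)" using bound[of y] pos by linarith
    then show ?thesis by (rule zero_less_mult_pos2) (use y0 in simp)
  qed
  moreover have "eigenvalue M c"
  proof -
    \<comment> \<open>By \<open>bound\<close> the form of \<open>?N\<close> is nonnegative, and it
      vanishes at the maximizer, so \<open>psd_kernel\<close> replaces a derivative
      argument.\<close>
    let ?N = "c *\<^sub>R mat 1 - M"
    have N: "?N *v z = c *\<^sub>R z - M *v z" for z
      by (simp add: matrix_vector_mult_diff_rdistrib scaleR_matrix_vector_assoc[symmetric])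
    have "transpose ?N = ?N"
      using sym by (simp add: vec_eq_iff transpose_def mat_def)
    moreover have "z \<bullet> (?N *v z) \<ge> 0" for z
      using bound[of z] by (simp add: N inner_diff_right)
    moreover have "x \<bullet> (?N *v x) = 0"
      using x by (simp add: N inner_diff_right c_def[symmetric] norm_eq_1)
    ultimately have "?N *v x = 0" by (rule psd_kernel)
    then show ?thesis using x unfolding eigenvalue_def by (intro exI[of _ x]) (auto simp: N)
  qed
  ultimately show ?thesis using that by blast
qed

text \<open>\<open>matrix_inv\<close> is a choice; a trivial kernel gives a left inverse, which for
  a square matrix is two-sided, so the choice succeeds.\<close>

lemma matrix_inv_both:
  fixes M :: "real^'n^'n::finite"
  assumes "\<And>x. M *v x = 0 \<Longrightarrow> x = 0"
  shows "M ** matrix_inv M = mat 1" "matrix_inv M ** M = mat 1"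
proof -
  have "\<exists>B. M ** B = mat 1 \<and> B ** M = mat 1"
    using matrix_left_invertible_ker[of M] assms matrix_left_right_inverse by blast
  then have "M ** matrix_inv M = mat 1 \<and> matrix_inv M ** M = mat 1"
    unfolding matrix_inv_def by (rule someI_ex)
  then show "M ** matrix_inv M = mat 1" "matrix_inv M ** M = mat 1" by auto
qed

text \<open>
  Schur's test: the weights \<open>\<kappa>\<close> turn \<open>W\<close> into a stochastic matrix, so the quadratic form
  of \<open>W\<close> is controlled by AM-GM applied with the ratio \<open>\<kappa>\<^sub>j / \<kappa>\<^sub>i\<close>.
\<close>

lemma schur_test:
  fixes W :: "real^'n^'n::finite"
  assumes sym: "transpose W = W" and nonneg: "\<And>i j. W $ i $ j \<ge> 0"
    and W: "W *v \<kappa> = 1" and K: "K > 0" "\<And>i. \<kappa> $ i \<ge> K"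
  shows "- (f \<bullet> (W *v f)) \<le> (f \<bullet> f) / K"
proof -
  have pos: "\<kappa> $ i > 0" for i using K(1) K(2)[of i] by linarith
  have row: "(\<Sum>j\<in>UNIV. W $ i $ j * \<kappa> $ j) = 1" for i
    using W by (simp add: vec_eq_iff matrix_vector_mult_def)
  have W_sym: "W $ i $ j = W $ j $ i" for i j
    using arg_cong[OF sym, of "\<lambda>M. M $ j $ i"] by (simp add: transpose_def)
  define T where "T i j = W $ i $ j * ((f $ i)\<^sup>2 * (\<kappa> $ j / \<kappa> $ i))" for i j
  have T_sum: "(\<Sum>i\<in>UNIV. \<Sum>j\<in>UNIV. T i j) = (\<Sum>i\<in>UNIV. (f $ i)\<^sup>2 / \<kappa> $ i)"
  proof (rule sum.cong[OF refl])
    fix i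
    have "(\<Sum>j\<in>UNIV. T i j) = (f $ i)\<^sup>2 / \<kappa> $ i * (\<Sum>j\<in>UNIV. W $ i $ j * \<kappa> $ j)"
      unfolding sum_distrib_left T_def by (intro sum.cong) (auto simp: field_simps)
    then show "(\<Sum>j\<in>UNIV. T i j) = (f $ i)\<^sup>2 / \<kappa> $ i" by (simp add: row)
  qed
  have amgm: "- (f $ i * (W $ i $ j * f $ j)) \<le> (T i j + T j i) / 2" for i j
  proof -
    \<comment> \<open>The plus sign yields a lower bound on the product of \<open>f $ i\<close> and
      \<open>f $ j\<close>, hence the upper bound on its negative.\<close>
    have "0 \<le> (f $ i * \<kappa> $ j + f $ j * \<kappa> $ i)\<^sup>2 / (\<kappa> $ i * \<kappa> $ j)"
      using pos[of i] pos[of j] by simp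
    also have "\<dots> = (f $ i)\<^sup>2 * (\<kappa> $ j / \<kappa> $ i) + (f $ j)\<^sup>2 * (\<kappa> $ i / \<kappa> $ j) + 2 * f $ i * f $ j"
      using pos[of i] pos[of j] by (simp add: field_simps power2_eq_square)
    finally have "0 \<le> W $ i $ j * \<dots>" using nonneg by simp
    then show ?thesis by (simp add: T_def W_sym[of j i] algebra_simps)
  qed
  have "- (f \<bullet> (W *v f)) = (\<Sum>i\<in>UNIV. \<Sum>j\<in>UNIV. - (f $ i * (W $ i $ j * f $ j)))"
    by (simp add: inner_vec_def matrix_vector_mult_def sum_distrib_left sum_negf)
  also have "\<dots> \<le> (\<Sum>i\<in>UNIV. \<Sum>j\<in>UNIV. (T i j + T j i) / 2)"
    by (intro sum_mono amgm)
  also have "\<dots> = ((\<Sum>i\<in>UNIV. \<Sum>j\<in>UNIV. T i j) + (\<Sum>i\<in>UNIV. \<Sum>j\<in>UNIV. T j i)) / 2"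
    by (simp add: sum.distrib sum_divide_distrib[symmetric])
  also have "\<dots> = (\<Sum>i\<in>UNIV. \<Sum>j\<in>UNIV. T i j)"
    by (subst (2) sum.swap) simp
  also have "\<dots> \<le> (\<Sum>i\<in>UNIV. (f $ i)\<^sup>2 / K)"
    unfolding T_sum using K pos by (intro sum_mono divide_left_mono) auto
  also have "\<dots> = (f \<bullet> f) / K"
    by (simp add: inner_vec_def sum_divide_distrib power2_eq_square)
  finally show ?thesis .
qed

section \<open>The Laplacian and the resistance matrix\<close>

context connected_graph
begin

abbreviation (input) L :: "real^'n^'n" where "L \<equiv> laplacian G"
abbreviation (input) H :: "real^'n^'n" where "H \<equiv> matrix_inv (Gamma_matrix G)"
abbreviation (input) \<Omega> :: "real^'n^'n" where "\<Omega> \<equiv> resistance_matrix G"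

text \<open>The diagonal of \<open>H\<close>, which carries the two rank-one terms of \<Omega> in
  \<open>resistance_mult\<close>.\<close>

definition \<zeta> :: "real^'n" where "\<zeta> = (\<chi> i. H $ i $ i)"

lemma arc_sym: "(i, j) \<in> parcs G \<longleftrightarrow> (j, i) \<in> parcs G"
  using arcs_symmetric by blast

lemma adjacency_sym: "adjacency_matrix G $ i $ j = adjacency_matrix G $ j $ i"
  using arc_sym by (simp add: adjacency_matrix_def)

lemma out_degree_eq_sum: "real (out_degree (with_proj G) i) = (\<Sum>j\<in>UNIV. adjacency_matrix G $ i $ j)"
proof -
  have "out_arcs (with_proj G) i = Pair i ` {j. (i, j) \<in> parcs G}"
    by (auto simp: out_arcs_def)
  then have "out_degree (with_proj G) i = card {j. (i, j) \<in> parcs G}"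
    by (simp add: out_degree_def card_image inj_on_def)
  then show ?thesis by (simp add: adjacency_matrix_def sum.If_cases)
qed

lemma laplacian_mult:
  "(L *v x) $ i = (\<Sum>j\<in>UNIV. adjacency_matrix G $ i $ j * (x $ i - x $ j))"
  by (simp add: laplacian_def degree_matrix_def matrix_vector_mult_def out_degree_eq_sum
      left_diff_distrib right_diff_distrib sum_subtractf if_distrib[of "\<lambda>a. a * _"]
      sum_distrib_right sum.If_cases)

lemma transpose_laplacian: "transpose L = L"
  using adjacency_sym by (auto simp: vec_eq_iff transpose_def laplacian_def degree_matrix_def)

lemma laplacian_ones: "L *v 1 = 0"
  by (simp add: vec_eq_iff laplacian_mult)

text \<open>Averaging the form with its copy under exchange of \<open>i\<close> and \<open>j\<close>
  completes the square; the half remains because each edge occurs in both orientations.\<close>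

lemma laplacian_form:
  "x \<bullet> (L *v x) = (\<Sum>i\<in>UNIV. \<Sum>j\<in>UNIV. adjacency_matrix G $ i $ j * (x $ i - x $ j)\<^sup>2) / 2"
proof -
  let ?a = "\<lambda>i j. adjacency_matrix G $ i $ j"
  have *: "x \<bullet> (L *v x) = (\<Sum>i\<in>UNIV. \<Sum>j\<in>UNIV. ?a i j * (x $ i * (x $ i - x $ j)))"
    by (simp add: inner_vec_def laplacian_mult sum_distrib_left mult.left_commute)
  also have "\<dots> = (\<Sum>i\<in>UNIV. \<Sum>j\<in>UNIV. ?a j i * (x $ j * (x $ j - x $ i)))"
    by (rule sum.swap)
  also have "\<dots> = (\<Sum>i\<in>UNIV. \<Sum>j\<in>UNIV. ?a i j * (x $ j * (x $ j - x $ i)))"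
    by (simp add: adjacency_sym)
  finally have "2 * (x \<bullet> (L *v x)) = (\<Sum>i\<in>UNIV. \<Sum>j\<in>UNIV. ?a i j * (x $ i * (x $ i - x $ j)))
    + (\<Sum>i\<in>UNIV. \<Sum>j\<in>UNIV. ?a i j * (x $ j * (x $ j - x $ i)))"
    using * by simp
  also have "\<dots> = (\<Sum>i\<in>UNIV. \<Sum>j\<in>UNIV. ?a i j * (x $ i - x $ j)\<^sup>2)"
    by (simp add: sum.distrib[symmetric] power2_eq_square algebra_simps)
  finally show ?thesis by simp
qed

lemma adjacency_nonneg: "adjacency_matrix G $ i $ j \<ge> 0"
  by (simp add: adjacency_matrix_def)

lemma laplacian_psd: "x \<bullet> (L *v x) \<ge> 0"
  unfolding laplacian_form by (intro divide_nonneg_nonneg sum_nonneg) (auto simp: adjacency_nonneg)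

lemma laplacian_kernel:
  assumes "x \<bullet> (L *v x) = 0"
  shows "x $ i = x $ j"
proof -
  have terms_zero: "adjacency_matrix G $ i $ j * (x $ i - x $ j)\<^sup>2 = 0" for i j
    using assms unfolding laplacian_form
    by (simp add: sum_nonneg_eq_0_iff sum_nonneg adjacency_nonneg)
  have edge: "x $ i = x $ j" if "(i, j) \<in> parcs G" for i j
    using terms_zero[of i j] that by (simp add: adjacency_matrix_def)
  \<comment> \<open>Connectedness is stated for the symmetric closure, which has the same
    reachability as the already symmetric \<open>G\<close>.\<close>
  have "i \<rightarrow>\<^sup>*\<^bsub>with_proj (mk_symmetric (with_proj G))\<^esub> j"
    using connected unfolding Digraph_Component.connected_def
    by (auto simp: strongly_connected_def verts_UNIV)
  then have "i \<rightarrow>\<^sup>*\<^bsub>with_proj G\<^esub> j"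
    by (simp only: reachable_mk_symmetric_eq[OF sym_arcs])
  then show ?thesis
  proof (induction rule: reachable_induct)
    case (step y z)
    then show ?case using edge[of y z] by simp
  qed simp
qed

lemma card_pos: "real CARD('n) > 0"
  using card_ge_2 by simp

section \<open>The matrix \<open>Gamma_matrix G\<close> and its inverse\<close>

lemma Gamma_mult: "Gamma_matrix G *v x = L *v x + ((1 \<bullet> x) / real CARD('n)) *\<^sub>R 1"
  by (simp add: Gamma_matrix_def laplacian_def matrix_vector_mult_add_rdistrib
      scaleR_matrix_vector_assoc[symmetric])
    (simp add: vec_eq_iff all_ones_def matrix_vector_mult_def inner_vec_def)

lemma transpose_Gamma: "transpose (Gamma_matrix G) = Gamma_matrix G"
  using adjacency_sym
  by (auto simp: vec_eq_iff transpose_def Gamma_matrix_def degree_matrix_def all_ones_def)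

lemma Gamma_form: "x \<bullet> (Gamma_matrix G *v x) = x \<bullet> (L *v x) + (1 \<bullet> x)\<^sup>2 / real CARD('n)"
  by (simp add: Gamma_mult inner_add_right inner_commute power2_eq_square)

lemma Gamma_psd: "x \<bullet> (Gamma_matrix G *v x) \<ge> 0"
  using laplacian_psd[of x] by (simp add: Gamma_form)

text \<open>Both summands of \<open>Gamma_form\<close> must vanish: the first makes \<open>x\<close>
  constant, the second makes it sum to zero.\<close>

lemma Gamma_definite:
  assumes "x \<bullet> (Gamma_matrix G *v x) = 0"
  shows "x = 0"
proof -
  have "(1 \<bullet> x)\<^sup>2 / real CARD('n) \<ge> 0" by simp
  then have "x \<bullet> (L *v x) = 0" "(1 \<bullet> x)\<^sup>2 / real CARD('n) = 0"
    using assms laplacian_psd[of x] unfolding Gamma_form by linarith+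
  then have const: "x $ i = x $ j" and "1 \<bullet> x = 0" for i j
    using laplacian_kernel by auto
  show ?thesis
  proof (rule vec_eq_iff[THEN iffD2], rule allI)
    fix i
    have "1 \<bullet> x = (\<Sum>j\<in>(UNIV::'n set). x $ i)"
      unfolding inner_vec_def by (intro sum.cong) (auto intro: const)
    then show "x $ i = 0 $ i" using \<open>1 \<bullet> x = 0\<close> by simp
  qed
qed

lemma H_mult: "Gamma_matrix G *v (H *v x) = x" "H *v (Gamma_matrix G *v x) = x"
proof -
  have ker: "x = 0" if "Gamma_matrix G *v x = 0" for x
    using that by (intro Gamma_definite) simp
  show "Gamma_matrix G *v (H *v x) = x" "H *v (Gamma_matrix G *v x) = x"
    using matrix_inv_both[OF ker] by (simp_all add: matrix_vector_mul_assoc)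
qed

lemma H_inner: "(H *v x) \<bullet> y = x \<bullet> (H *v y)"
  by (metis H_mult(1) symmetric_matrix_inner[OF transpose_Gamma])

lemma H_entry: "H $ i $ j = axis i 1 \<bullet> (H *v axis j 1)"
  by (simp add: inner_axis' matrix_vector_mult_basis column_def)

lemma H_sym: "H $ i $ j = H $ j $ i"
  unfolding H_entry by (metis H_inner inner_commute)

lemma H_psd: "x \<bullet> (H *v x) \<ge> 0"
  using Gamma_psd[of "H *v x"] by (simp add: H_mult inner_commute)

lemma H_definite: "x \<bullet> (H *v x) = 0 \<Longrightarrow> x = 0"
  using Gamma_definite[of "H *v x"] H_mult(1)[of x] by (simp add: inner_commute)

lemma ones_inner_ones: "(1 :: real^'n) \<bullet> 1 = real CARD('n)"
  by (simp add: inner_vec_def)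

lemma H_ones: "H *v 1 = 1"
proof -
  have "Gamma_matrix G *v 1 = 1"
    by (simp add: Gamma_mult laplacian_ones ones_inner_ones)
  then show ?thesis by (metis H_mult(2))
qed

lemma ones_inner_laplacian: "1 \<bullet> (L *v x) = 0"
  using symmetric_matrix_inner[OF transpose_laplacian, of 1 x] by (simp add: laplacian_ones)

text \<open>\<open>H\<close> inverts \<open>L\<close> up to the projection onto constants, because
  \<open>H\<close> fixes the all-ones vector.\<close>

lemma H_laplacian: "H *v (L *v x) = x - ((1 \<bullet> x) / real CARD('n)) *\<^sub>R 1"
proof -
  have "L *v x = Gamma_matrix G *v x - ((1 \<bullet> x) / real CARD('n)) *\<^sub>R 1" by (simp add: Gamma_mult)
  then show ?thesis
    by (simp add: matrix_vector_mult_diff_distrib H_mult H_ones matrix_vector_mult_scaleR)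
qed

section \<open>Resistance as a quadratic form\<close>

lemma resistance_entry: "\<Omega> $ i $ j = H $ i $ i + H $ j $ j - 2 * H $ i $ j"
  by (simp add: resistance_matrix_def Let_def)

lemma resistance_form:
  "\<Omega> $ i $ j = (axis i 1 - axis j 1) \<bullet> (H *v (axis i 1 - axis j 1))"
  unfolding matrix_vector_mult_diff_distrib inner_diff_left inner_diff_right H_entry[symmetric]
  by (simp add: resistance_entry H_sym[of j i])

lemma resistance_nonneg: "\<Omega> $ i $ j \<ge> 0"
  unfolding resistance_form by (rule H_psd)

lemma resistance_pos:
  assumes "i \<noteq> j"
  shows "\<Omega> $ i $ j > 0"
proof -
  have "axis i 1 - axis j 1 \<noteq> (0 :: real^'n)"
    using assms by (simp add: axis_eq_axis)
  then show ?thesis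
    using H_definite[of "axis i 1 - axis j 1"] H_psd[of "axis i 1 - axis j 1"]
    unfolding resistance_form less_le by metis
qed

lemma transpose_resistance: "transpose \<Omega> = \<Omega>"
  using H_sym by (auto simp: vec_eq_iff transpose_def resistance_entry)

lemma resistance_mult:
  "\<Omega> *v x = (1 \<bullet> x) *\<^sub>R \<zeta> + (\<zeta> \<bullet> x) *\<^sub>R 1 - 2 *\<^sub>R (H *v x)"
  by (simp add: vec_eq_iff matrix_vector_mult_def resistance_entry \<zeta>_def inner_vec_def
      algebra_simps sum.distrib sum_subtractf sum_distrib_left sum_distrib_right)

lemma resistance_form_zero_sum:
  "1 \<bullet> x = 0 \<Longrightarrow> x \<bullet> (\<Omega> *v x) = - 2 * (x \<bullet> (H *v x))"
  by (simp add: resistance_mult inner_diff_right inner_commute)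

section \<open>The curvature equation\<close>

text \<open>Two distinct vertices supply one positive entry. The total is used to show that the
  constant \<open>c\<close> in \<open>curvature_exists\<close> is nonzero.\<close>

lemma resistance_sum_pos: "1 \<bullet> (\<Omega> *v 1) > 0"
proof -
  obtain i j :: 'n where "i \<noteq> j"
    using card_ge_2 card_le_Suc0_iff_eq[of "UNIV :: 'n set"] by (auto simp: numeral_2_eq_2)
  have "0 < \<Omega> $ i $ j" by (rule resistance_pos) fact
  also have "\<dots> \<le> (\<Sum>j\<in>UNIV. \<Omega> $ i $ j)"
    by (rule member_le_sum) (auto simp: resistance_nonneg)
  also have "\<dots> \<le> (\<Sum>i\<in>UNIV. \<Sum>j\<in>UNIV. \<Omega> $ i $ j)"
    by (rule member_le_sum[of i UNIV "\<lambda>i. \<Sum>j\<in>UNIV. \<Omega> $ i $ j"])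
      (auto intro: sum_nonneg simp: resistance_nonneg)
  finally show ?thesis by (simp add: inner_vec_def matrix_vector_mult_def)
qed

text \<open>
  The curvature is proportional to \<open>1/n + L \<zeta> / 2\<close>: applying \<open>L\<close> to the curvature equation
  and using \<open>L H = I - J/n\<close> leaves no other candidate.
\<close>

lemma curvature_exists: "\<exists>\<kappa>. \<Omega> *v \<kappa> = 1"
proof -
  define p where "p = (1 / real CARD('n)) *\<^sub>R 1 + (1 / 2) *\<^sub>R (L *v \<zeta>)"
  have sum_p: "1 \<bullet> p = 1"
    using card_pos by (simp add: p_def inner_add_right ones_inner_laplacian ones_inner_ones)
  \<comment> \<open>In \<open>\<Omega> *v p\<close> the terms in \<zeta> cancel; \<open>c\<close>
    collects the remaining multiples of the all-ones vector.\<close>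
  define c where "c = \<zeta> \<bullet> p + (1 \<bullet> \<zeta>) / real CARD('n) - 2 / real CARD('n)"
  have Hp: "H *v p = (1 / real CARD('n)) *\<^sub>R 1 + (1 / 2) *\<^sub>R (\<zeta> - ((1 \<bullet> \<zeta>) / real CARD('n)) *\<^sub>R 1)"
    by (simp only: p_def matrix_vector_right_distrib matrix_vector_mult_scaleR H_ones H_laplacian)
  have \<Omega>p: "\<Omega> *v p = c *\<^sub>R 1"
    unfolding resistance_mult Hp sum_p by (simp add: c_def vec_eq_iff algebra_simps)
  \<comment> \<open>Computing the sum of the entries of \<open>\<Omega> *v p\<close> a second way,
    by symmetry of \<Omega>, shows that \<open>c\<close> is positive, so \<open>p\<close> can be
    rescaled.\<close>
  have "c * real CARD('n) = 1 \<bullet> (\<Omega> *v p)" by (simp add: \<Omega>p ones_inner_ones)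
  also have "\<dots> = (\<Omega> *v 1) \<bullet> p"
    by (simp add: symmetric_matrix_inner[OF transpose_resistance])
  also have "\<dots> = (1 \<bullet> (\<Omega> *v 1)) / real CARD('n) + (real CARD('n) / 2) * (\<zeta> \<bullet> (L *v \<zeta>))"
  proof -
    have "(\<Omega> *v 1) \<bullet> (L *v \<zeta>) = real CARD('n) * (\<zeta> \<bullet> (L *v \<zeta>))"
      by (simp add: resistance_mult H_ones inner_diff_left inner_add_left ones_inner_laplacian
          ones_inner_ones)
    then show ?thesis by (simp add: p_def inner_add_right inner_commute[of "\<Omega> *v 1" 1])
  qed
  also have "\<dots> > 0"
    using resistance_sum_pos card_pos laplacian_psd[of \<zeta>] by (intro add_pos_nonneg) auto
  finally have "c \<noteq> 0" by auto
  then have "\<Omega> *v ((1 / c) *\<^sub>R p) = 1" by (simp add: matrix_vector_mult_scaleR \<Omega>p)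
  then show ?thesis by blast
qed

text \<open>
  Pairing a kernel vector of \<open>\<Omega>\<close> with the curvature shows that it sums to zero, and on such
  vectors \<open>\<Omega>\<close> is negative definite.
\<close>

lemma resistance_kernel:
  assumes "\<Omega> *v x = 0"
  shows "x = 0"
proof -
  obtain \<kappa> where \<kappa>: "\<Omega> *v \<kappa> = 1" using curvature_exists by blast
  have "1 \<bullet> x = 0"
    using symmetric_matrix_inner[OF transpose_resistance, of \<kappa> x] assms by (simp add: \<kappa>)
  then have "x \<bullet> (H *v x) = 0" using resistance_form_zero_sum[of x] assms by simp
  then show ?thesis by (rule H_definite)
qed

text \<open>The trivial kernel of \<Omega> gives the uniqueness that \<open>THE\<close>
  requires.\<close>

lemma resistance_curvature: "\<Omega> *v resistance_curvature G = 1"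
proof -
  obtain \<kappa> where \<kappa>: "\<Omega> *v \<kappa> = 1" using curvature_exists by blast
  have "\<kappa>' = \<kappa>" if "\<Omega> *v \<kappa>' = 1" for \<kappa>'
    using resistance_kernel[of "\<kappa>' - \<kappa>"] that \<kappa> by (simp add: matrix_vector_mult_diff_distrib)
  then show ?thesis unfolding resistance_curvature_def by (rule theI[of "\<lambda>\<kappa>. \<Omega> *v \<kappa> = 1", OF \<kappa>])
qed

section \<open>The spectral gap\<close>

lemma eigenvalue_bound:
  assumes K: "K > 0" "\<And>v. resistance_curvature G $ v \<ge> K"
    and c: "eigenvalue L c" "c > 0"
  shows "c \<ge> 2 * K"
proof -
  obtain f where f: "f \<noteq> 0" "L *v f = c *\<^sub>R f" using c(1) unfolding eigenvalue_def by blast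
  have sum_f: "1 \<bullet> f = 0"
    using ones_inner_laplacian[of f] f(2) c(2) by simp
  \<comment> \<open>On zero-sum vectors \<open>Gamma_matrix G\<close> acts as \<open>L\<close>, so
    \<open>f\<close> is an eigenvector of \<open>H\<close> for \<open>1 / c\<close>.\<close>
  then have "Gamma_matrix G *v f = c *\<^sub>R f" by (simp add: Gamma_mult f(2))
  then have "f = c *\<^sub>R (H *v f)" by (metis H_mult(2) matrix_vector_mult_scaleR)
  then have "f \<bullet> f = c * (f \<bullet> (H *v f))" by (metis inner_scaleR_right)
  then have "2 * (f \<bullet> f) / c = - (f \<bullet> (\<Omega> *v f))"
    using c(2) by (simp add: resistance_form_zero_sum[OF sum_f])
  also have "\<dots> \<le> (f \<bullet> f) / K"
    by (rule schur_test[OF transpose_resistance resistance_nonneg resistance_curvature K])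
  finally have "(2 * K) * (f \<bullet> f) \<le> c * (f \<bullet> f)"
    using c(2) K(1) by (simp add: field_simps)
  then show ?thesis using f(1) by (simp add: mult_le_cancel_right inner_gt_zero_iff less_le)
qed

lemma laplacian_positive_eigenvalue:
  obtains c where "eigenvalue L c" "c > 0"
proof -
  obtain i j :: 'n where ij: "i \<noteq> j"
    using card_ge_2 card_le_Suc0_iff_eq[of "UNIV :: 'n set"] by (auto simp: numeral_2_eq_2)
  \<comment> \<open>With a second vertex present, a basis vector is not constant and so has positive
    energy.\<close>
  define y :: "real^'n" where "y = axis i 1"
  have "y $ i \<noteq> y $ j" using ij by (simp add: y_def axis_def)
  then have "y \<bullet> (L *v y) > 0"
    using laplacian_kernel[of y i j] laplacian_psd[of y] by linarith
  then show ?thesis using symmetric_positive_eigenvalue[OF transpose_laplacian] that by blast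
qed

end

theorem theorem2:
  fixes G :: "'n::finite pair_pre_digraph" and K :: real
  assumes "connected_graph G"
    and "K > 0"
    and "\<forall>v. resistance_curvature G $ v \<ge> K"
  shows "lambda2 G \<ge> 2 * K"
proof -
  interpret connected_graph G by fact
  let ?E = "{c. eigenvalue (laplacian G) c \<and> c > 0}"
  have "finite ?E"
    using finite_eigenvalues_symmetric[OF transpose_laplacian] by (rule rev_finite_subset) auto
  moreover have "?E \<noteq> {}" using laplacian_positive_eigenvalue by blast
  \<comment> \<open>As a member of \<open>?E\<close>, the minimum is itself a positive eigenvalue,
    and the bound applies to it.\<close>
  ultimately have "Min ?E \<in> ?E" by (rule Min_in)
  then show ?thesis
    unfolding lambda2_def using eigenvalue_bound[of K] assms by blast
qed

end
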